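(* Let $(X,\leq,\mathcal{B}_X)$ and $(Y,\leq,\mathcal{B}_Y)$ be objects of the category $\mathsf{hFor}$. Then $(X\otimes Y,\preceq,\mathcal{B}_X\otimes\mathcal{B}_Y)$ (with the maps $\overline{\pi_1}:X\otimes Y\to X$ and $\overline{\pi_2}:X\otimes Y\to Y$) is the product of $(X,\leq,\mathcal{B}_X)$ and $(Y,\leq,\mathcal{B}_Y)$ in $\mathsf{hFor}$.
   Context: A finite forest is a finite poset $F$ such that $(x]=\{y:y\le x\}$ is a chain for every $x\in F$. An order-preserving map $f:F\to G$ between forests is open if for all $x\in F$, $y\in G$ with $y\le f(x)$ there is $z\le x$ with $f(z)=y$. For a subset $U$ of a poset, $U^m$ is the set of minimal elements of $U$ and $[U)$ is the upset generated by $U$; $[x)=[\{x\})$. An $h$-base for a finite forest $F$ is a family $\mathcal{B}$ of upsets of $F$ such that (1) $[x)\in\mathcal{B}$ for every $x\in F$; (2) if $B\in\mathcal{B}$ and $M\subseteq B^m$ then $[M)\in\mathcal{B}$. The objects of $\mathsf{hFor}$ are triples $(X,\le,\mathcal{B}_X)$ with $(X,\le)$ a finite forest and $\mathcal{B}_X$ an $h$-base for it with $X\in\mathcal{B}_X$; morphisms $(X,\le,\mathcal{B}_X)\to(Y,\le,\mathcal{B}_Y)$ are order-preserving open maps $f:X\to Y$ with $f^{-1}(U)\in\mathcal{B}_X$ for every $U\in\mathcal{B}_Y$. For a finite poset $F$, $\mathrm{US}(F)$ is the set of sets $\{f_0,\dots,f_n\}\subseteq F$ with $f_0$ minimal in $F$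 and $f_0<\dots<f_n$, ordered by $\{f_0<\dots<f_n\}\preceq\{g_0<\dots<g_m\}$ iff $n\le m$ and $f_i=g_i$ for $i=0,\dots,n$. With $\pi_1,\pi_2$ the coordinate projections of the product poset $X\times Y$ and $\hat\pi_j(p)=\{\pi_j(p_0),\dots,\pi_j(p_k)\}$ for $p=\{p_0<\dots<p_k\}$, $$X\otimes Y=\{p=\{p_0<\dots<p_k\}\in\mathrm{US}(X\times Y):\hat\pi_1(p)=(\pi_1(p_k)],\ \hat\pi_2(p)=(\pi_2(p_k)]\},$$ ordered by $\preceq$, and $\overline{\pi_j}(p)=\max\hat\pi_j(p)$. $\mathcal{B}_X\otimes\mathcal{B}_Y$ is the family of subsets $U$ of $X\otimes Y$ satisfying at least one of: (1) $U=[u)$ for some $u\in X\otimes Y$; (2) $U=[T)$ for some $T\subseteq[(\overline{\pi_1})^{-1}(V)]^m$ with $V\in\mathcal{B}_X$; (3) $U=[T)$ for some $T\subseteq[(\overline{\pi_2})^{-1}(V)]^m$ with $V\in\mathcal{B}_Y$ (where $[\,\cdot\,]^m$ denotes the set of minimal elements). *)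

theory Defs
  imports Main "HOL-Library.FuncSet"
begin

text \<open>
  Since \<^term>\<open>partial_order_on X r\<close> includes \<open>r \<subseteq> X \<times> X\<close>, \<^term>\<open>under r x\<close> is the principal downset
  \<open>(x]\<close>, and the relational image \<^term>\<open>r `` U\<close> is the upset \<open>[U)\<close> generated by \<open>U\<close>.
\<close>

definition finite_forest :: "'a set \<Rightarrow> 'a rel \<Rightarrow> bool" where
  "finite_forest X r \<longleftrightarrow> finite X \<and> partial_order_on X r \<and> (\<forall>x\<in>X. under r x \<in> Chains r)"

definition minimals :: "'a rel \<Rightarrow> 'a set \<Rightarrow> 'a set" where
  "minimals r U = {x \<in> U. \<forall>y\<in>U. (y, x) \<in> r \<longrightarrow> y = x}"

definition greatest_elem :: "'a rel \<Rightarrow> 'a set \<Rightarrow> 'a" where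
  "greatest_elem r U = (THE m. m \<in> U \<and> (\<forall>x\<in>U. (x, m) \<in> r))"

definition upset :: "'a set \<Rightarrow> 'a rel \<Rightarrow> 'a set \<Rightarrow> bool" where
  "upset X r U \<longleftrightarrow> U \<subseteq> X \<and> (\<forall>x\<in>U. \<forall>y. (x, y) \<in> r \<longrightarrow> y \<in> U)"

definition h_base :: "'a set \<Rightarrow> 'a rel \<Rightarrow> 'a set set \<Rightarrow> bool" where
  "h_base X r \<B> \<longleftrightarrow>
     (\<forall>B\<in>\<B>. upset X r B) \<and>
     (\<forall>x\<in>X. r `` {x} \<in> \<B>) \<and>
     (\<forall>B\<in>\<B>. \<forall>M. M \<subseteq> minimals r B \<longrightarrow> r `` M \<in> \<B>)"

record 'a hforest =
  pts :: "'a set"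
  leq :: "'a rel"
  base :: "'a set set"

definition hFor_obj :: "'a hforest \<Rightarrow> bool" where
  "hFor_obj X \<longleftrightarrow>
     finite_forest (pts X) (leq X) \<and> h_base (pts X) (leq X) (base X) \<and> pts X \<in> base X"

text \<open>
  Morphisms are taken extensional (\<open>undefined\<close> outside the domain), so that equality of
  morphisms is equality of HOL functions.
\<close>

definition hFor_hom :: "'a hforest \<Rightarrow> 'b hforest \<Rightarrow> ('a \<Rightarrow> 'b) set" where
  "hFor_hom X Y = {f \<in> pts X \<rightarrow>\<^sub>E pts Y.
     (\<forall>x\<in>pts X. \<forall>x'\<in>pts X. (x, x') \<in> leq X \<longrightarrow> (f x, f x') \<in> leq Y) \<and>
     (\<forall>x\<in>pts X. \<forall>y\<in>pts Y. (y, f x) \<in> leq Y \<longrightarrow> (\<exists>z\<in>pts X. (z, x) \<in> leq X \<and> f z = y)) \<and>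
     (\<forall>U\<in>base Y. f -` U \<inter> pts X \<in> base X)}"

text \<open>
  The universal property is tested against all objects carried by the type \<open>'z\<close>; a theorem
  that leaves \<open>'z\<close> free as a type variable asserts it for objects over every type.
\<close>

definition hFor_product ::
  "'z itself \<Rightarrow> 'a hforest \<Rightarrow> 'b hforest \<Rightarrow> 'p hforest \<Rightarrow> ('p \<Rightarrow> 'a) \<Rightarrow> ('p \<Rightarrow> 'b) \<Rightarrow> bool" where
  "hFor_product _ X Y P p1 p2 \<longleftrightarrow>
     hFor_obj P \<and> p1 \<in> hFor_hom P X \<and> p2 \<in> hFor_hom P Y \<and>
     (\<forall>Z :: 'z hforest. hFor_obj Z \<longrightarrow>
       (\<forall>f\<in>hFor_hom Z X. \<forall>g\<in>hFor_hom Z Y.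
         \<exists>!h. h \<in> hFor_hom Z P \<and> compose (pts Z) p1 h = f \<and> compose (pts Z) p2 h = g))"

text \<open>
  The list \<open>fs\<close> is the increasing enumeration \<open>f\<^sub>0 < \<dots> < f\<^sub>n\<close> of an element of \<open>US(F)\<close>; the
  element itself is \<^term>\<open>set fs\<close>.
\<close>

definition us_enum :: "'a set \<Rightarrow> 'a rel \<Rightarrow> 'a list \<Rightarrow> bool" where
  "us_enum F r fs \<longleftrightarrow>
     fs \<noteq> [] \<and> set fs \<subseteq> F \<and> hd fs \<in> minimals r F \<and>
     sorted_wrt (\<lambda>x y. (x, y) \<in> r \<and> x \<noteq> y) fs"

definition US :: "'a set \<Rightarrow> 'a rel \<Rightarrow> 'a set set" where
  "US F r = {set fs | fs. us_enum F r fs}"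

definition US_le :: "'a set \<Rightarrow> 'a rel \<Rightarrow> 'a set rel" where
  "US_le F r = {(set fs, set gs) | fs gs. us_enum F r fs \<and> us_enum F r gs \<and>
     length fs \<le> length gs \<and> (\<forall>i<length fs. fs ! i = gs ! i)}"

definition prod_le :: "'a rel \<Rightarrow> 'b rel \<Rightarrow> ('a \<times> 'b) rel" where
  "prod_le r s = {((a, b), (a', b')) | a b a' b'. (a, a') \<in> r \<and> (b, b') \<in> s}"

definition tensor_pts :: "'a hforest \<Rightarrow> 'b hforest \<Rightarrow> ('a \<times> 'b) set set" where
  "tensor_pts X Y = {p \<in> US (pts X \<times> pts Y) (prod_le (leq X) (leq Y)).
     \<exists>ps. us_enum (pts X \<times> pts Y) (prod_le (leq X) (leq Y)) ps \<and> p = set ps \<and>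
       fst ` p = under (leq X) (fst (last ps)) \<and>
       snd ` p = under (leq Y) (snd (last ps))}"

definition tensor_le :: "'a hforest \<Rightarrow> 'b hforest \<Rightarrow> ('a \<times> 'b) set rel" where
  "tensor_le X Y = US_le (pts X \<times> pts Y) (prod_le (leq X) (leq Y))
     \<inter> tensor_pts X Y \<times> tensor_pts X Y"

definition proj1 :: "'a hforest \<Rightarrow> 'b hforest \<Rightarrow> ('a \<times> 'b) set \<Rightarrow> 'a" where
  "proj1 X Y = (\<lambda>p\<in>tensor_pts X Y. greatest_elem (leq X) (fst ` p))"

definition proj2 :: "'a hforest \<Rightarrow> 'b hforest \<Rightarrow> ('a \<times> 'b) set \<Rightarrow> 'b" where
  "proj2 X Y = (\<lambda>p\<in>tensor_pts X Y. greatest_elem (leq Y) (snd ` p))"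

definition tensor_base :: "'a hforest \<Rightarrow> 'b hforest \<Rightarrow> ('a \<times> 'b) set set set" where
  "tensor_base X Y = {U. U \<subseteq> tensor_pts X Y \<and>
     ((\<exists>u\<in>tensor_pts X Y. U = tensor_le X Y `` {u}) \<or>
      (\<exists>V\<in>base X. \<exists>T. T \<subseteq> minimals (tensor_le X Y) (proj1 X Y -` V \<inter> tensor_pts X Y) \<and>
         U = tensor_le X Y `` T) \<or>
      (\<exists>V\<in>base Y. \<exists>T. T \<subseteq> minimals (tensor_le X Y) (proj2 X Y -` V \<inter> tensor_pts X Y) \<and>
         U = tensor_le X Y `` T))}"

definition tensor :: "'a hforest \<Rightarrow> 'b hforest \<Rightarrow> ('a \<times> 'b) set hforest" where
  "tensor X Y = \<lparr>pts = tensor_pts X Y, leq = tensor_le X Y, base = tensor_base X Y\<rparr>"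

end

theory Submission
  imports Defs
begin

text \<open>
  A point of \<open>X \<otimes> Y\<close> is a chain in \<open>X \<times> Y\<close> with a greatest element, its tip, and the two
  projections read off the coordinates of the tip.  Everything rests on one observation: the points
  below \<open>p\<close> are exactly its initial segments \<open>{y \<in> p. y \<le> x}\<close>, one for each \<open>x \<in> p\<close>, and the
  segment cut off at \<open>x\<close> has tip \<open>x\<close> (\<open>initial_segment\<close>, \<open>tensor_le_segment\<close>).  So the downset of
  \<open>p\<close> is a copy of the chain \<open>p\<close>, which makes \<open>X \<otimes> Y\<close> a forest, and because the coordinates of
  \<open>p\<close> fill the downsets below its tip, the projections are open.

  Given \<open>f : Z \<rightarrow> X\<close> and \<open>g : Z \<rightarrow> Y\<close>, the observation forces the mediating map.  An open map \<open>h\<close>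
  sends \<open>{w. w \<le> z}\<close> onto the downset of \<open>h z\<close>, whose tips are the elements of \<open>h z\<close>; the tip of
  \<open>h w\<close> must be \<open>(f w, g w)\<close>, hence \<open>h z = {(f w, g w) | w \<le> z}\<close>.  Conversely this set is a chain
  since \<open>{w. w \<le> z}\<close> is one, and openness of \<open>f\<close> and \<open>g\<close> makes it a point of \<open>X \<otimes> Y\<close>.

  For the h-bases, all members of \<open>\<B>\<^sub>X \<otimes> \<B>\<^sub>Y\<close> are brought to one form, \<open>[T)\<close> with \<open>T\<close> among the
  minimal elements of the preimage of some \<open>V\<close> under a projection \<open>\<pi>\<close>.  A principal upset \<open>[u)\<close>
  has this form because a point \<open>u\<close> with tip \<open>(a, b)\<close> is minimal in the preimage of
  \<open>[a)\<close> or in that of \<open>[b)\<close> (\<open>principal_upset_generator\<close>).  If \<open>\<pi> \<circ> h = f\<close> then the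
  minimal elements of \<open>h\<^sup>-\<^sup>1[T)\<close> are minimal in \<open>f\<^sup>-\<^sup>1 V\<close>, so that the h-base of \<open>Z\<close> contains
  \<open>h\<^sup>-\<^sup>1[T)\<close> (\<open>vimage_upset_of_minimals\<close>).
\<close>

section \<open>Finite posets\<close>

lemma partial_order_onD:
  assumes "partial_order_on A r"
  shows "r \<subseteq> A \<times> A" and "\<And>x. x \<in> A \<Longrightarrow> (x, x) \<in> r"
    and "\<And>x y z. (x, y) \<in> r \<Longrightarrow> (y, z) \<in> r \<Longrightarrow> (x, z) \<in> r"
    and "\<And>x y. (x, y) \<in> r \<Longrightarrow> (y, x) \<in> r \<Longrightarrow> x = y"
  using assms unfolding partial_order_on_def preorder_on_def refl_on_def trans_def antisym_def
  by blast+

lemma minimal_below: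
  assumes r: "partial_order_on A r" and "finite U" and "x \<in> U"
  shows "\<exists>m\<in>minimals r U. (m, x) \<in> r \<or> m = x"
  using assms(2,3)
proof (induction "card {y \<in> U. (y, x) \<in> r}" arbitrary: x rule: less_induct)
  case less
  note D = partial_order_onD[OF r]
  show ?case
  proof (cases "x \<in> minimals r U")
    case False
    then obtain y where y: "y \<in> U" "(y, x) \<in> r" "y \<noteq> x"
      using less.prems unfolding minimals_def by blast
    have "{z \<in> U. (z, y) \<in> r} \<subset> {z \<in> U. (z, x) \<in> r}"
      using y D(2)[of x] D(2)[of y] D(1) D(3)[of _ y x] D(4)[of x y] less.prems by blast
    then have "card {z \<in> U. (z, y) \<in> r} < card {z \<in> U. (z, x) \<in> r}"
      using less.prems by (intro psubset_card_mono) auto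
    from less.hyps[OF this less.prems(1) y(1)] show ?thesis
      using y(2) D(3)[OF _ y(2)] by blast
  qed blast
qed

lemma upset_generated_by_minimals:
  assumes r: "partial_order_on A r" and A: "finite A" and U: "upset A r U"
  shows "r `` minimals r U = U"
proof
  show "r `` minimals r U \<subseteq> U"
    using U unfolding upset_def minimals_def by blast
  show "U \<subseteq> r `` minimals r U"
  proof
    fix x assume x: "x \<in> U"
    have UA: "U \<subseteq> A" using U unfolding upset_def by blast
    then obtain m where "m \<in> minimals r U" "(m, x) \<in> r \<or> m = x"
      using minimal_below[OF r finite_subset[OF UA A] x] by blast
    then show "x \<in> r `` minimals r U"
      using partial_order_onD(2)[OF r, of x] x UA by blast
  qed
qed

lemma upset_Image:
  assumes r: "partial_order_on A r"
  shows "upset A r (r `` M)"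
  using partial_order_onD(1,3)[OF r] unfolding upset_def by blast

text \<open>
  A set of minimal elements is an antichain, so passing to \<open>[T)\<close> adds no new minimal elements.  A
  family of such upsets thus satisfies the second h-base axiom as soon as the sets \<open>T\<close> allowed in it
  are closed under subsets.
\<close>

lemma minimals_upset_of_minimals:
  assumes r: "partial_order_on A r" and T: "T \<subseteq> minimals r W"
  shows "minimals r (r `` T) \<subseteq> T"
proof
  fix x assume x: "x \<in> minimals r (r `` T)"
  then obtain t where t: "t \<in> T" "(t, x) \<in> r" unfolding minimals_def by blast
  moreover have "(t, t) \<in> r" using t(2) partial_order_onD(1,2)[OF r] by blast
  ultimately show "x \<in> T" using x unfolding minimals_def by blast
qed

definition open_mono :: "'a set \<Rightarrow> 'a rel \<Rightarrow> 'b set \<Rightarrow> 'b rel \<Rightarrow> ('a \<Rightarrow> 'b) \<Rightarrow> bool" where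
  "open_mono A r B s f \<longleftrightarrow> f \<in> A \<rightarrow> B \<and>
     (\<forall>x\<in>A. \<forall>x'\<in>A. (x, x') \<in> r \<longrightarrow> (f x, f x') \<in> s) \<and>
     (\<forall>x\<in>A. \<forall>y\<in>B. (y, f x) \<in> s \<longrightarrow> (\<exists>z\<in>A. (z, x) \<in> r \<and> f z = y))"

lemma hFor_hom_iff:
  "f \<in> hFor_hom X Y \<longleftrightarrow> f \<in> extensional (pts X) \<and>
     open_mono (pts X) (leq X) (pts Y) (leq Y) f \<and> (\<forall>U\<in>base Y. f -` U \<inter> pts X \<in> base X)"
  unfolding hFor_hom_def open_mono_def PiE_def by blast

lemma image_under_open_mono:
  assumes f: "open_mono A r B s f" and r: "partial_order_on A r" and s: "partial_order_on B s"
    and x: "x \<in> A"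
  shows "f ` under r x = under s (f x)"
proof
  show "f ` under r x \<subseteq> under s (f x)"
    using f x partial_order_onD(1)[OF r] unfolding open_mono_def under_def by blast
  show "under s (f x) \<subseteq> f ` under r x"
    using f x partial_order_onD(1)[OF s] unfolding open_mono_def under_def by blast
qed

text \<open>
  Openness of \<open>h\<close> is what transports minimality backwards.  If \<open>z\<close> is minimal in \<open>h\<^sup>-\<^sup>1[T)\<close> and
  \<open>t \<in> T\<close> lies below \<open>h z\<close>, then \<open>t\<close> lifts to a point below \<open>z\<close>, which must be \<open>z\<close>, so \<open>h z = t\<close>.
  A point \<open>y \<le> z\<close> with \<open>f y \<in> V\<close> now satisfies \<open>h y \<le> t\<close> and \<open>\<pi> (h y) \<in> V\<close>, so \<open>h y = t\<close> by
  minimality of \<open>t\<close>, and again \<open>y = z\<close>.  Hence all minimal elements of \<open>h\<^sup>-\<^sup>1[T)\<close> are minimal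
  in \<open>f\<^sup>-\<^sup>1 V\<close>, and the second h-base axiom of \<open>Z\<close> applies.
\<close>

lemma vimage_upset_of_minimals:
  assumes Z: "hFor_obj Z" and P: "partial_order_on P s"
    and h: "open_mono (pts Z) (leq Z) P s h"
    and f: "\<And>z. z \<in> pts Z \<Longrightarrow> \<pi> (h z) = f z"
    and V: "f -` V \<inter> pts Z \<in> base Z"
    and T: "T \<subseteq> minimals s (\<pi> -` V \<inter> P)"
  shows "h -` (s `` T) \<inter> pts Z \<in> base Z"
proof -
  let ?W = "h -` (s `` T) \<inter> pts Z"
  have r: "partial_order_on (pts Z) (leq Z)" and fin: "finite (pts Z)"
    and hb: "h_base (pts Z) (leq Z) (base Z)"
    using Z unfolding hFor_obj_def finite_forest_def by auto
  note R = partial_order_onD[OF r] and S = partial_order_onD[OF P]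
  have hP: "\<And>z. z \<in> pts Z \<Longrightarrow> h z \<in> P"
    and mono: "\<And>w z. (w, z) \<in> leq Z \<Longrightarrow> (h w, h z) \<in> s"
    and lift: "\<And>z q. z \<in> pts Z \<Longrightarrow> (q, h z) \<in> s \<Longrightarrow> \<exists>w\<in>pts Z. (w, z) \<in> leq Z \<and> h w = q"
    using h R(1) S(1) unfolding open_mono_def by blast+
  have TP: "T \<subseteq> P" using T unfolding minimals_def by blast
  have up: "upset (pts Z) (leq Z) ?W"
    unfolding upset_def using mono R(1) S(3) by blast
  have "minimals (leq Z) ?W \<subseteq> minimals (leq Z) (f -` V \<inter> pts Z)"
  proof
    fix z assume z: "z \<in> minimals (leq Z) ?W"
    then have zZ: "z \<in> pts Z" unfolding minimals_def by blast
    from z obtain t where t: "t \<in> T" "(t, h z) \<in> s" unfolding minimals_def by blast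
    then obtain w where w: "w \<in> pts Z" "(w, z) \<in> leq Z" "h w = t" using lift zZ by blast
    have memW: "\<And>w. w \<in> pts Z \<Longrightarrow> h w = t \<Longrightarrow> w \<in> ?W" using t TP S(2) by blast
    have hz: "h z = t" using z w memW[of w] unfolding minimals_def by blast
    have "t \<in> minimals s (\<pi> -` V \<inter> P)" using t T by blast
    then have tm: "\<pi> t \<in> V" "\<And>q. q \<in> P \<Longrightarrow> \<pi> q \<in> V \<Longrightarrow> (q, t) \<in> s \<Longrightarrow> q = t"
      unfolding minimals_def by blast+
    have "y = z" if y: "y \<in> f -` V \<inter> pts Z" "(y, z) \<in> leq Z" for y
    proof -
      have "h y = t" using tm(2)[of "h y"] y hP mono[OF y(2)] hz f by auto
      then show ?thesis using z y memW[of y] unfolding minimals_def by blast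
    qed
    then show "z \<in> minimals (leq Z) (f -` V \<inter> pts Z)"
      using zZ tm(1) hz f[OF zZ] unfolding minimals_def by auto
  qed
  then have "leq Z `` minimals (leq Z) ?W \<in> base Z"
    using hb V unfolding h_base_def by blast
  then show ?thesis using upset_generated_by_minimals[OF r fin up] by simp
qed

section \<open>Chains as sets\<close>

text \<open>
  The two characterisations \<open>US_iff\<close> and \<open>US_le_iff\<close> replace enumerating lists by sets: membership
  becomes being a finite chain that meets the minimal elements, and the prefix order becomes
  inclusion as an initial segment.
\<close>

lemma enumerate_finite_chain:
  assumes r: "partial_order_on A r" and "finite p" and "p \<subseteq> A" and "p \<in> Chains r"
  shows "\<exists>fs. set fs = p \<and> sorted_wrt (\<lambda>x y. (x, y) \<in> r \<and> x \<noteq> y) fs"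
  using assms(2-4)
proof (induction p rule: finite_induct)
  case empty
  show ?case by (rule exI[of _ "[]"]) simp
next
  case (insert x p)
  note D = partial_order_onD[OF r]
  have "p \<in> Chains r" using insert.prems unfolding Chains_def by blast
  with insert obtain fs where fs: "set fs = p" "sorted_wrt (\<lambda>x y. (x, y) \<in> r \<and> x \<noteq> y) fs"
    by auto
  have cmp: "\<And>y. y \<in> p \<Longrightarrow> (y, x) \<in> r \<or> (x, y) \<in> r"
    using insert.prems unfolding Chains_def by blast
  \<comment> \<open>Insert \<open>x\<close> at its place: the elements below it first, then \<open>x\<close>, then those above it.\<close>
  let ?gs = "filter (\<lambda>y. (y, x) \<in> r) fs @ x # filter (\<lambda>y. (y, x) \<notin> r) fs"
  have "set ?gs = insert x p" using fs(1) by auto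
  moreover have "sorted_wrt (\<lambda>x y. (x, y) \<in> r \<and> x \<noteq> y) ?gs"
  proof -
    have "(y, z) \<in> r \<and> y \<noteq> z" if "y \<in> p" "z \<in> p" "(y, x) \<in> r" "(z, x) \<notin> r" for y z
      using that cmp[of z] D(3)[of y x z] by auto
    moreover have "(x, z) \<in> r" if "z \<in> p" "(z, x) \<notin> r" for z
      using that cmp[of z] by auto
    ultimately show ?thesis
      using fs insert.hyps(2) by (auto simp: sorted_wrt_append sorted_wrt_filter)
  qed
  ultimately show ?case by blast
qed

lemma sorted_chain:
  assumes r: "partial_order_on A r" and "set fs \<subseteq> A"
    and "sorted_wrt (\<lambda>x y. (x, y) \<in> r \<and> x \<noteq> y) fs"
  shows "set fs \<in> Chains r"
    and "x \<in> set fs \<Longrightarrow> (hd fs, x) \<in> r" and "x \<in> set fs \<Longrightarrow> (x, last fs) \<in> r"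
proof -
  note D = partial_order_onD[OF r]
  show "set fs \<in> Chains r"
    using assms(2,3) by (induction fs) (auto simp: Chains_def D(2))
  show "(hd fs, x) \<in> r" if "x \<in> set fs"
    using that assms(2,3) D(2) by (cases fs) auto
  show "(x, last fs) \<in> r" if "x \<in> set fs"
    using that assms(2,3) D(2) by (cases fs rule: rev_cases) (auto simp: sorted_wrt_append)
qed

lemma US_iff:
  assumes r: "partial_order_on A r"
  shows "p \<in> US A r \<longleftrightarrow> finite p \<and> p \<subseteq> A \<and> p \<in> Chains r \<and> p \<inter> minimals r A \<noteq> {}"
    (is "?l \<longleftrightarrow> ?r")
proof
  assume ?l
  then obtain fs where fs: "p = set fs" "us_enum A r fs" unfolding US_def by blast
  then have "set fs \<in> Chains r" "hd fs \<in> set fs" "set fs \<subseteq> A" "hd fs \<in> minimals r A"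
    using sorted_chain(1)[OF r, of fs] unfolding us_enum_def by simp_all
  then show ?r unfolding fs(1) by (auto intro!: IntI)
next
  assume p: ?r
  then obtain fs where fs: "set fs = p" "sorted_wrt (\<lambda>x y. (x, y) \<in> r \<and> x \<noteq> y) fs"
    using enumerate_finite_chain[OF r, of p] by blast
  obtain m where m: "m \<in> p" "m \<in> minimals r A" using p by blast
  have "(hd fs, m) \<in> r" using sorted_chain(2)[OF r _ fs(2)] fs(1) m p by blast
  moreover have ne: "fs \<noteq> []" using m fs by auto
  then have "hd fs \<in> A" using fs p hd_in_set by blast
  ultimately have "hd fs = m" using m unfolding minimals_def by blast
  then show ?l using fs m p ne unfolding US_def us_enum_def by auto
qed

lemma US_enum:
  assumes r: "partial_order_on A r" and "p \<in> US A r"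
  obtains fs where "us_enum A r fs" "set fs = p"
  using assms unfolding US_def by blast

lemma US_le_iff:
  assumes r: "partial_order_on A r"
  shows "(p, q) \<in> US_le A r \<longleftrightarrow> p \<in> US A r \<and> q \<in> US A r \<and> p \<subseteq> q \<and>
           (\<forall>x\<in>p. \<forall>y\<in>q. (y, x) \<in> r \<longrightarrow> y \<in> p)" (is "?l \<longleftrightarrow> ?r")
proof
  note D = partial_order_onD[OF r]
  assume ?l
  then obtain fs gs where fg: "p = set fs" "q = set gs" "us_enum A r fs" "us_enum A r gs"
      "length fs \<le> length gs" "\<And>i. i < length fs \<Longrightarrow> fs ! i = gs ! i"
    unfolding US_le_def by auto
  have down: "y \<in> p" if xy: "x \<in> p" "y \<in> q" "(y, x) \<in> r" for x y
  proof -
    obtain i where i: "i < length fs" "x = gs ! i"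
      using xy(1) fg(1,6) by (auto simp: in_set_conv_nth)
    obtain j where j: "j < length gs" "y = gs ! j"
      using xy(2) fg(2) by (auto simp: in_set_conv_nth)
    have "j \<le> i"
    proof (rule ccontr)
      assume "\<not> j \<le> i"
      then have "(x, y) \<in> r \<and> x \<noteq> y"
        using sorted_wrt_nth_less[of _ gs i j] fg(4) i j unfolding us_enum_def by auto
      then show False using D(4) xy(3) by blast
    qed
    then have "j < length fs" using i(1) by simp
    then show ?thesis using j(2) fg(1) fg(6)[of j] nth_mem[of j fs] by simp
  qed
  then have "\<forall>x\<in>p. \<forall>y\<in>q. (y, x) \<in> r \<longrightarrow> y \<in> p"
    by (intro ballI impI) (rule down)
  moreover have "p \<subseteq> q"
  proof
    fix x assume "x \<in> p"
    then obtain i where "i < length fs" "x = gs ! i"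
      using fg(1,6) by (auto simp: in_set_conv_nth)
    then show "x \<in> q" using fg(2,5) by simp
  qed
  moreover have "p \<in> US A r" using fg(1,3) unfolding US_def by blast
  moreover have "q \<in> US A r" using fg(2,4) unfolding US_def by blast
  ultimately show ?r by (intro conjI)
next
  note D = partial_order_onD[OF r]
  assume R: ?r
  then obtain fs where fs: "us_enum A r fs" "set fs = p" unfolding US_def by blast
  have q: "finite q" "q \<subseteq> A" "q \<in> Chains r" using R US_iff[OF r, of q] by auto
  \<comment> \<open>Any enumeration of \<open>p\<close> extends by one of \<open>q - p\<close>, since every new element lies above \<open>p\<close>.\<close>
  then have "q - p \<in> Chains r" unfolding Chains_def by blast
  with q obtain ds where ds: "set ds = q - p" "sorted_wrt (\<lambda>x y. (x, y) \<in> r \<and> x \<noteq> y) ds"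
    using enumerate_finite_chain[OF r, of "q - p"] by auto
  have "(x, y) \<in> r \<and> x \<noteq> y" if "x \<in> p" "y \<in> q - p" for x y
    using that R q(3) unfolding Chains_def by blast
  then have "us_enum A r (fs @ ds)"
    using fs ds q R unfolding us_enum_def by (auto simp: sorted_wrt_append)
  moreover have q_eq: "set (fs @ ds) = q" using fs ds R by auto
  ultimately have "(set fs, set (fs @ ds)) \<in> US_le A r"
    unfolding US_le_def mem_Collect_eq using fs(1)
    by (intro exI[of _ fs] exI[of _ "fs @ ds"]) (simp add: nth_append)
  then show ?l using fs(2) q_eq by simp
qed

lemma partial_order_prod_le:
  assumes r: "partial_order_on A r" and s: "partial_order_on B s"
  shows "partial_order_on (A \<times> B) (prod_le r s)"
proof -
  note R = partial_order_onD[OF r] and S = partial_order_onD[OF s]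
  have mem: "\<And>a b c d. ((a, b), (c, d)) \<in> prod_le r s \<longleftrightarrow> (a, c) \<in> r \<and> (b, d) \<in> s"
    unfolding prod_le_def by simp
  have "prod_le r s \<subseteq> (A \<times> B) \<times> (A \<times> B)"
    using R(1) S(1) unfolding prod_le_def by blast
  moreover have "refl_on (A \<times> B) (prod_le r s)"
    using R(2) S(2) unfolding refl_on_def by (simp add: mem split: prod.splits)
  moreover have "trans (prod_le r s)"
    using R(3) S(3) unfolding trans_def by (simp add: mem split_paired_All) blast
  moreover have "antisym (prod_le r s)"
    using R(4) S(4) unfolding antisym_def by (simp add: mem split_paired_All)
  ultimately show ?thesis unfolding partial_order_on_def preorder_on_def by blast
qed


lemma greatest_elem_eq:
  assumes "partial_order_on A r" and "m \<in> U" and "\<And>x. x \<in> U \<Longrightarrow> (x, m) \<in> r"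
  shows "greatest_elem r U = m"
  unfolding greatest_elem_def
  using assms(2,3) partial_order_onD(4)[OF assms(1)] by (intro the_equality) blast+

section \<open>The forest of the tensor product\<close>

lemma tensor_sel [simp]:
  "pts (tensor X Y) = tensor_pts X Y" "leq (tensor X Y) = tensor_le X Y"
  "base (tensor X Y) = tensor_base X Y"
  unfolding tensor_def by simp_all

context
  fixes X :: "'a hforest" and Y :: "'b hforest"
  assumes X: "hFor_obj X" and Y: "hFor_obj Y"
begin

abbreviation "grid \<equiv> pts X \<times> pts Y"
abbreviation "grid_le \<equiv> prod_le (leq X) (leq Y)"
abbreviation "tip p \<equiv> (proj1 X Y p, proj2 X Y p)"

lemma partial_orders:
  shows po_X: "partial_order_on (pts X) (leq X)" and po_Y: "partial_order_on (pts Y) (leq Y)"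
    and po_grid: "partial_order_on grid grid_le"
proof -
  show *: "partial_order_on (pts X) (leq X)" "partial_order_on (pts Y) (leq Y)"
    using X Y unfolding hFor_obj_def finite_forest_def by auto
  show "partial_order_on grid grid_le" by (rule partial_order_prod_le[OF *])
qed

lemma finite_grid: "finite grid"
  using X Y unfolding hFor_obj_def finite_forest_def by auto

lemma grid_le_iff: "(u, v) \<in> grid_le \<longleftrightarrow> (fst u, fst v) \<in> leq X \<and> (snd u, snd v) \<in> leq Y"
  unfolding prod_le_def by (cases u; cases v) simp

lemma tensor_pts_iff:
  "p \<in> tensor_pts X Y \<longleftrightarrow> p \<in> US grid grid_le \<and>
     (\<exists>m\<in>p. (\<forall>x\<in>p. (x, m) \<in> grid_le) \<and>
        fst ` p = under (leq X) (fst m) \<and> snd ` p = under (leq Y) (snd m))" (is "?l \<longleftrightarrow> ?r")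
proof
  assume ?l
  then obtain ps where ps: "p \<in> US grid grid_le" "us_enum grid grid_le ps" "p = set ps"
      "fst ` p = under (leq X) (fst (last ps))" "snd ` p = under (leq Y) (snd (last ps))"
    unfolding tensor_pts_def by blast
  have "(x, last ps) \<in> grid_le" if "x \<in> p" for x
    using sorted_chain(3)[OF po_grid, of ps x] that ps(2,3) unfolding us_enum_def by simp
  moreover have "last ps \<in> p" using ps(2,3) unfolding us_enum_def by simp
  ultimately show ?r using ps(1,4,5) by blast
next
  assume ?r
  then obtain m where m: "p \<in> US grid grid_le" "m \<in> p" "\<And>x. x \<in> p \<Longrightarrow> (x, m) \<in> grid_le"
      "fst ` p = under (leq X) (fst m)" "snd ` p = under (leq Y) (snd m)" by blast
  obtain ps where ps: "us_enum grid grid_le ps" "set ps = p" using US_enum[OF po_grid m(1)] .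
  have "(m, last ps) \<in> grid_le"
    using sorted_chain(3)[OF po_grid, of ps m] m(2) ps unfolding us_enum_def by simp
  moreover have "last ps \<in> p" using ps unfolding us_enum_def by auto
  ultimately have "last ps = m" using m(3) partial_order_onD(4)[OF po_grid] by blast
  then show ?l using m(1,4,5) ps unfolding tensor_pts_def by blast
qed

lemma tensorI:
  assumes p: "p \<in> US grid grid_le" and m: "m \<in> p" "\<And>x. x \<in> p \<Longrightarrow> (x, m) \<in> grid_le"
    and im: "fst ` p = under (leq X) (fst m)" "snd ` p = under (leq Y) (snd m)"
  shows "p \<in> tensor_pts X Y" and "tip p = m"
proof -
  show T: "p \<in> tensor_pts X Y" using assms unfolding tensor_pts_iff by blast
  have "greatest_elem (leq X) (fst ` p) = fst m" "greatest_elem (leq Y) (snd ` p) = snd m"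
    using m grid_le_iff
    by (auto intro!: greatest_elem_eq[OF po_X] greatest_elem_eq[OF po_Y])
  then show "tip p = m" using T unfolding proj1_def proj2_def by simp
qed

lemma tensorD:
  assumes "p \<in> tensor_pts X Y"
  shows "p \<in> US grid grid_le" and "tip p \<in> p" and "\<And>x. x \<in> p \<Longrightarrow> (x, tip p) \<in> grid_le"
    and "fst ` p = under (leq X) (proj1 X Y p)" and "snd ` p = under (leq Y) (proj2 X Y p)"
proof -
  obtain m where m: "p \<in> US grid grid_le" "m \<in> p" "\<And>x. x \<in> p \<Longrightarrow> (x, m) \<in> grid_le"
      "fst ` p = under (leq X) (fst m)" "snd ` p = under (leq Y) (snd m)"
    using assms unfolding tensor_pts_iff by blast
  have t: "tip p = m" using tensorI(2)[OF m] .
  show "p \<in> US grid grid_le" by fact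
  show "tip p \<in> p" unfolding t by fact
  show "\<And>x. x \<in> p \<Longrightarrow> (x, tip p) \<in> grid_le" unfolding t by fact
  show "fst ` p = under (leq X) (proj1 X Y p)" "snd ` p = under (leq Y) (proj2 X Y p)"
    using m(4,5) t by auto
qed

lemma tensor_chain:
  assumes "p \<in> tensor_pts X Y" and "x \<in> p" and "y \<in> p"
  shows "(x, y) \<in> grid_le \<or> (y, x) \<in> grid_le"
  using tensorD(1)[OF assms(1)] assms(2,3) US_iff[OF po_grid] unfolding Chains_def by blast

lemma tensor_subset_grid: "p \<in> tensor_pts X Y \<Longrightarrow> p \<subseteq> grid"
  using tensorD(1) US_iff[OF po_grid] by blast

lemma tensor_le_iff:
  "(p, q) \<in> tensor_le X Y \<longleftrightarrow> p \<in> tensor_pts X Y \<and> q \<in> tensor_pts X Y \<and> p \<subseteq> q \<and>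
     (\<forall>x\<in>p. \<forall>y\<in>q. (y, x) \<in> grid_le \<longrightarrow> y \<in> p)"
  using US_le_iff[OF po_grid, of p q] tensorD(1)[of p] tensorD(1)[of q]
  unfolding tensor_le_def by blast

text \<open>
  The points below \<open>p\<close>: cutting \<open>p\<close> at one of its elements \<open>x\<close> stays inside \<open>X \<otimes> Y\<close>.  A
  coordinate below that of \<open>x\<close> is attained somewhere in \<open>p\<close>; if it is attained only above \<open>x\<close>, then
  by antisymmetry it is the coordinate of \<open>x\<close> itself.
\<close>

lemma initial_segment:
  assumes p: "p \<in> tensor_pts X Y" and x: "x \<in> p"
  shows "({y \<in> p. (y, x) \<in> grid_le}, p) \<in> tensor_le X Y"
    and "tip {y \<in> p. (y, x) \<in> grid_le} = x"
proof -
  let ?q = "{y \<in> p. (y, x) \<in> grid_le}"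
  note D = partial_order_onD[OF po_grid]
  have pp: "finite p" "p \<subseteq> grid" "p \<in> Chains grid_le" "p \<inter> minimals grid_le grid \<noteq> {}"
    using tensorD(1)[OF p] US_iff[OF po_grid] by blast+
  obtain m where m: "m \<in> p" "m \<in> minimals grid_le grid" using pp(4) by blast
  have xx: "(x, x) \<in> grid_le" using D(2) pp(2) x by blast
  have "(m, x) \<in> grid_le"
  proof (rule ccontr)
    assume n: "(m, x) \<notin> grid_le"
    then have "(x, m) \<in> grid_le" using tensor_chain[OF p m(1) x] by blast
    then have "x = m" using m(2) pp(2) x unfolding minimals_def by blast
    then show False using n xx by simp
  qed
  then have "m \<in> ?q \<inter> minimals grid_le grid" using m by blast
  moreover have "?q \<in> Chains grid_le" using pp(3) unfolding Chains_def by blast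
  ultimately have US: "?q \<in> US grid grid_le"
    using pp(1,2) unfolding US_iff[OF po_grid] by auto
  \<comment> \<open>The same argument serves both coordinates.\<close>
  have seg: "\<pi> ` ?q = under r (\<pi> x)"
    if im: "\<pi> ` p = under r (\<pi> (tip p))" and po: "partial_order_on C r"
      and mono: "\<And>u v. (u, v) \<in> grid_le \<Longrightarrow> (\<pi> u, \<pi> v) \<in> r" for \<pi> :: "'a \<times> 'b \<Rightarrow> 'c" and r C
  proof
    note E = partial_order_onD[OF po]
    show "\<pi> ` ?q \<subseteq> under r (\<pi> x)" using mono unfolding under_def by blast
    show "under r (\<pi> x) \<subseteq> \<pi> ` ?q"
    proof
      fix a assume "a \<in> under r (\<pi> x)"
      then have a: "(a, \<pi> x) \<in> r" unfolding under_def by simp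
      have "(\<pi> x, \<pi> (tip p)) \<in> r" using mono tensorD(3)[OF p x] .
      then have "a \<in> \<pi> ` p" using a E(3) unfolding im under_def by blast
      then obtain y where y: "y \<in> p" "a = \<pi> y" by blast
      show "a \<in> \<pi> ` ?q"
      proof (cases "(y, x) \<in> grid_le")
        case True
        then show ?thesis using y by blast
      next
        case False
        then have "(x, y) \<in> grid_le" using tensor_chain[OF p x y(1)] by blast
        then have "a = \<pi> x" using mono a y(2) E(4) by blast
        then show ?thesis using x xx by blast
      qed
    qed
  qed
  have "fst ` ?q = under (leq X) (fst x)"
    by (rule seg[OF _ po_X]) (simp_all add: tensorD(4)[OF p] grid_le_iff)
  moreover have "snd ` ?q = under (leq Y) (snd x)"
    by (rule seg[OF _ po_Y]) (simp_all add: tensorD(5)[OF p] grid_le_iff)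
  moreover have "x \<in> ?q" using x xx by blast
  ultimately have q: "?q \<in> tensor_pts X Y" and t: "tip ?q = x"
    using tensorI[OF US, of x] by blast+
  show "tip ?q = x" by fact
  have "y \<in> ?q" if "u \<in> ?q" "y \<in> p" "(y, u) \<in> grid_le" for u y
    using that D(3)[of y u x] by simp
  then show "(?q, p) \<in> tensor_le X Y" unfolding tensor_le_iff using p q by blast
qed

text \<open>
  Conversely, a point below \<open>p\<close> is recovered from \<open>p\<close> and its own tip, so that two points below \<open>p\<close>
  with equal tips coincide.
\<close>

lemma tensor_le_segment:
  assumes "(q, p) \<in> tensor_le X Y"
  shows "tip q \<in> p" and "q = {y \<in> p. (y, tip q) \<in> grid_le}"
proof -
  have q: "q \<in> tensor_pts X Y" "q \<subseteq> p" "\<And>x y. x \<in> q \<Longrightarrow> y \<in> p \<Longrightarrow> (y, x) \<in> grid_le \<Longrightarrow> y \<in> q"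
    using assms unfolding tensor_le_iff by blast+
  show "tip q \<in> p" using tensorD(2)[OF q(1)] q(2) by blast
  show "q = {y \<in> p. (y, tip q) \<in> grid_le}"
    using tensorD(2,3)[OF q(1)] q(2) q(3)[of "tip q"] by blast
qed

lemma tip_mono:
  assumes "(q, p) \<in> tensor_le X Y"
  shows "(tip q, tip p) \<in> grid_le"
  using tensor_le_segment(1)[OF assms] tensorD(3) assms unfolding tensor_le_iff by blast

lemma po_tensor: "partial_order_on (tensor_pts X Y) (tensor_le X Y)"
proof -
  have "trans (tensor_le X Y)"
  proof (rule transI)
    fix p q u assume a: "(p, q) \<in> tensor_le X Y" "(q, u) \<in> tensor_le X Y"
    have "y \<in> p" if "x \<in> p" "y \<in> u" "(y, x) \<in> grid_le" for x y
    proof -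
      have "x \<in> q" using a(1) that(1) unfolding tensor_le_iff by blast
      then have "y \<in> q" using a(2) that(2,3) unfolding tensor_le_iff by blast
      then show ?thesis using a(1) that(1,3) unfolding tensor_le_iff by blast
    qed
    moreover have "p \<subseteq> u" "p \<in> tensor_pts X Y" "u \<in> tensor_pts X Y"
      using a unfolding tensor_le_iff by blast+
    ultimately show "(p, u) \<in> tensor_le X Y" unfolding tensor_le_iff by blast
  qed
  moreover have "antisym (tensor_le X Y)"
    by (rule antisymI) (auto simp only: tensor_le_iff)
  moreover have "refl_on (tensor_pts X Y) (tensor_le X Y)"
    by (rule refl_onI) (auto simp only: tensor_le_iff)
  moreover have "tensor_le X Y \<subseteq> tensor_pts X Y \<times> tensor_pts X Y"
    unfolding tensor_le_def by blast
  ultimately show ?thesis unfolding partial_order_on_def preorder_on_def by blast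
qed

lemma finite_tensor: "finite (tensor_pts X Y)"
  by (rule finite_subset[of _ "Pow grid"]) (use tensor_subset_grid finite_grid in auto)

lemma segments_comparable:
  assumes q: "(q, p) \<in> tensor_le X Y" and q': "(q', p) \<in> tensor_le X Y"
    and le: "(tip q, tip q') \<in> grid_le"
  shows "(q, q') \<in> tensor_le X Y"
proof -
  note S = tensor_le_segment[OF q] and S' = tensor_le_segment[OF q']
  have "q \<subseteq> q'"
  proof
    fix x assume "x \<in> q"
    then have "x \<in> p" "(x, tip q) \<in> grid_le" using S(2) by blast+
    then show "x \<in> q'" using S'(2) partial_order_onD(3)[OF po_grid _ le] by blast
  qed
  moreover have "q' \<subseteq> p" using q' unfolding tensor_le_iff by blast
  ultimately show ?thesis using q q' unfolding tensor_le_iff by blast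
qed

lemma forest_tensor: "finite_forest (tensor_pts X Y) (tensor_le X Y)"
proof -
  have "under (tensor_le X Y) p \<in> Chains (tensor_le X Y)" if p: "p \<in> tensor_pts X Y" for p
  proof -
    have "(q, q') \<in> tensor_le X Y \<or> (q', q) \<in> tensor_le X Y"
      if "(q, p) \<in> tensor_le X Y" "(q', p) \<in> tensor_le X Y" for q q'
      using tensor_chain[OF p tensor_le_segment(1)[OF that(1)] tensor_le_segment(1)[OF that(2)]]
        segments_comparable that by blast
    then show ?thesis unfolding Chains_def under_def by blast
  qed
  then show ?thesis unfolding finite_forest_def using finite_tensor po_tensor by blast
qed

section \<open>The tensor product as an object of the category\<close>

lemma open_mono_proj:
  shows open_mono_proj1: "open_mono (tensor_pts X Y) (tensor_le X Y) (pts X) (leq X) (proj1 X Y)"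
    and open_mono_proj2: "open_mono (tensor_pts X Y) (tensor_le X Y) (pts Y) (leq Y) (proj2 X Y)"
proof -
  have mem: "proj1 X Y p \<in> pts X" "proj2 X Y p \<in> pts Y" if "p \<in> tensor_pts X Y" for p
    using tensorD(2)[OF that] tensor_subset_grid[OF that] by blast+
  have mono: "(proj1 X Y q, proj1 X Y p) \<in> leq X" "(proj2 X Y q, proj2 X Y p) \<in> leq Y"
    if "(q, p) \<in> tensor_le X Y" for q p
    using tip_mono[OF that] unfolding grid_le_iff by simp_all
  have lift: "\<exists>q\<in>tensor_pts X Y. (q, p) \<in> tensor_le X Y \<and> tip q = x"
    if "p \<in> tensor_pts X Y" "x \<in> p" for p x
    using initial_segment[OF that] tensor_le_iff by blast
  have "\<exists>q\<in>tensor_pts X Y. (q, p) \<in> tensor_le X Y \<and> proj1 X Y q = a"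
    if p: "p \<in> tensor_pts X Y" and a: "(a, proj1 X Y p) \<in> leq X" for p a
  proof -
    have "a \<in> fst ` p" using tensorD(4)[OF p] a unfolding under_def by simp
    then obtain x where "x \<in> p" "fst x = a" by blast
    then show ?thesis using lift[OF p, of x] by auto
  qed
  then show "open_mono (tensor_pts X Y) (tensor_le X Y) (pts X) (leq X) (proj1 X Y)"
    unfolding open_mono_def using mem mono by blast
  have "\<exists>q\<in>tensor_pts X Y. (q, p) \<in> tensor_le X Y \<and> proj2 X Y q = a"
    if p: "p \<in> tensor_pts X Y" and a: "(a, proj2 X Y p) \<in> leq Y" for p a
  proof -
    have "a \<in> snd ` p" using tensorD(5)[OF p] a unfolding under_def by simp
    then obtain x where "x \<in> p" "snd x = a" by blast
    then show ?thesis using lift[OF p, of x] by auto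
  qed
  then show "open_mono (tensor_pts X Y) (tensor_le X Y) (pts Y) (leq Y) (proj2 X Y)"
    unfolding open_mono_def using mem mono by blast
qed

text \<open>
  If \<open>u\<close> were minimal in neither preimage, there would be \<open>q\<close> and \<open>q'\<close> strictly below \<open>u\<close> whose
  tips agree with the tip of \<open>u\<close> in the first and in the second coordinate, respectively.  These
  tips are elements of the chain \<open>u\<close>, and the larger of the two then agrees with the tip of \<open>u\<close> in
  both coordinates, which makes the corresponding segment equal to \<open>u\<close>.
\<close>

lemma principal_upset_generator:
  assumes u: "u \<in> tensor_pts X Y"
  shows "u \<in> minimals (tensor_le X Y) (proj1 X Y -` (leq X `` {proj1 X Y u}) \<inter> tensor_pts X Y) \<or>
         u \<in> minimals (tensor_le X Y) (proj2 X Y -` (leq Y `` {proj2 X Y u}) \<inter> tensor_pts X Y)"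
    (is "u \<in> minimals _ ?V \<or> u \<in> minimals _ ?W")
proof (rule ccontr)
  assume neg: "\<not> ?thesis"
  have "tip u \<in> grid" using tensorD(2)[OF u] tensor_subset_grid[OF u] by blast
  then have "u \<in> ?V" "u \<in> ?W"
    using u partial_order_onD(2)[OF po_X] partial_order_onD(2)[OF po_Y] by auto
  with neg obtain q q' where
    q: "q \<in> ?V" "(q, u) \<in> tensor_le X Y" "q \<noteq> u" and
    q': "q' \<in> ?W" "(q', u) \<in> tensor_le X Y" "q' \<noteq> u"
    unfolding minimals_def by blast
  have same: "w = u" if w: "(w, u) \<in> tensor_le X Y" and "tip w = tip u" for w
    using tensor_le_segment(2)[OF w] that(2) tensorD(3)[OF u] by auto
  have 1: "proj1 X Y q = proj1 X Y u"
    using q(1) tip_mono[OF q(2)] partial_order_onD(4)[OF po_X] unfolding grid_le_iff by auto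
  have 2: "proj2 X Y q' = proj2 X Y u"
    using q'(1) tip_mono[OF q'(2)] partial_order_onD(4)[OF po_Y] unfolding grid_le_iff by auto
  have "(tip q, tip q') \<in> grid_le \<or> (tip q', tip q) \<in> grid_le"
    using tensor_chain[OF u tensor_le_segment(1)[OF q(2)] tensor_le_segment(1)[OF q'(2)]] .
  then show False
  proof
    assume "(tip q, tip q') \<in> grid_le"
    then have "proj1 X Y q' = proj1 X Y u"
      using 1 tip_mono[OF q'(2)] partial_order_onD(4)[OF po_X] unfolding grid_le_iff by auto
    then show False using same[OF q'(2)] 2 q'(3) by simp
  next
    assume "(tip q', tip q) \<in> grid_le"
    then have "proj2 X Y q = proj2 X Y u"
      using 2 tip_mono[OF q(2)] partial_order_onD(4)[OF po_Y] unfolding grid_le_iff by auto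
    then show False using same[OF q(2)] 1 q(3) by simp
  qed
qed

text \<open>
  Working with the generators of an upset instead of the upset itself makes the second h-base axiom
  a matter of closure under subsets.
\<close>

definition generating :: "('a \<times> 'b) set set \<Rightarrow> bool" where
  "generating T \<longleftrightarrow>
     (\<exists>V\<in>base X. T \<subseteq> minimals (tensor_le X Y) (proj1 X Y -` V \<inter> tensor_pts X Y)) \<or>
     (\<exists>V\<in>base Y. T \<subseteq> minimals (tensor_le X Y) (proj2 X Y -` V \<inter> tensor_pts X Y))"

lemma generating_subset: "generating T \<Longrightarrow> M \<subseteq> T \<Longrightarrow> generating M"
  unfolding generating_def using order_trans[of M T] by blast

lemma generating_singleton:
  assumes u: "u \<in> tensor_pts X Y"
  shows "generating {u}"
proof -
  have "tip u \<in> grid" using tensorD(2)[OF u] tensor_subset_grid[OF u] by blast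
  then have "leq X `` {proj1 X Y u} \<in> base X" "leq Y `` {proj2 X Y u} \<in> base Y"
    using X Y unfolding hFor_obj_def h_base_def by auto
  then show ?thesis using principal_upset_generator[OF u]
    unfolding generating_def insert_subset by (elim disjE) (auto intro: bexI)
qed

lemma tensor_base_iff: "U \<in> tensor_base X Y \<longleftrightarrow> (\<exists>T. generating T \<and> U = tensor_le X Y `` T)"
proof
  assume "\<exists>T. generating T \<and> U = tensor_le X Y `` T"
  moreover have "tensor_le X Y `` T \<subseteq> tensor_pts X Y" for T
    using tensor_le_iff by blast
  ultimately show "U \<in> tensor_base X Y"
    unfolding tensor_base_def generating_def by blast
next
  assume "U \<in> tensor_base X Y"
  then have "(\<exists>u\<in>tensor_pts X Y. U = tensor_le X Y `` {u}) \<or>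
      (\<exists>V\<in>base X. \<exists>T. T \<subseteq> minimals (tensor_le X Y) (proj1 X Y -` V \<inter> tensor_pts X Y) \<and>
         U = tensor_le X Y `` T) \<or>
      (\<exists>V\<in>base Y. \<exists>T. T \<subseteq> minimals (tensor_le X Y) (proj2 X Y -` V \<inter> tensor_pts X Y) \<and>
         U = tensor_le X Y `` T)"
    unfolding tensor_base_def mem_Collect_eq by (rule conjunct2)
  then show "\<exists>T. generating T \<and> U = tensor_le X Y `` T"
  proof (elim disjE bexE exE conjE)
    fix u assume "u \<in> tensor_pts X Y" "U = tensor_le X Y `` {u}"
    then show ?thesis using generating_singleton by (intro exI[of _ "{u}"]) simp
  next
    fix V T assume "V \<in> base X" "U = tensor_le X Y `` T"
      "T \<subseteq> minimals (tensor_le X Y) (proj1 X Y -` V \<inter> tensor_pts X Y)"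
    then show ?thesis unfolding generating_def by (intro exI[of _ T]) auto
  next
    fix V T assume "V \<in> base Y" "U = tensor_le X Y `` T"
      "T \<subseteq> minimals (tensor_le X Y) (proj2 X Y -` V \<inter> tensor_pts X Y)"
    then show ?thesis unfolding generating_def by (intro exI[of _ T]) auto
  qed
qed

lemma vimage_proj_in_base:
  shows "V \<in> base X \<Longrightarrow> proj1 X Y -` V \<inter> tensor_pts X Y \<in> tensor_base X Y"
    and "W \<in> base Y \<Longrightarrow> proj2 X Y -` W \<inter> tensor_pts X Y \<in> tensor_base X Y"
proof -
  have up: "upset (tensor_pts X Y) (tensor_le X Y) (\<pi> -` V \<inter> tensor_pts X Y)"
    if \<pi>: "open_mono (tensor_pts X Y) (tensor_le X Y) C r \<pi>" and V: "upset C r V"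
    for \<pi> :: "('a \<times> 'b) set \<Rightarrow> 'c" and C r V
    using \<pi> V tensor_le_iff unfolding open_mono_def upset_def by blast
  show "proj1 X Y -` V \<inter> tensor_pts X Y \<in> tensor_base X Y" if V: "V \<in> base X"
  proof -
    have "upset (pts X) (leq X) V" using X V unfolding hFor_obj_def h_base_def by blast
    note eq = upset_generated_by_minimals[OF po_tensor finite_tensor up[OF open_mono_proj1 this]]
    have "generating (minimals (tensor_le X Y) (proj1 X Y -` V \<inter> tensor_pts X Y))"
      unfolding generating_def using V by blast
    then show ?thesis unfolding tensor_base_iff using eq by metis
  qed
  show "proj2 X Y -` W \<inter> tensor_pts X Y \<in> tensor_base X Y" if V: "W \<in> base Y"
  proof -
    have "upset (pts Y) (leq Y) W" using Y V unfolding hFor_obj_def h_base_def by blast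
    note eq = upset_generated_by_minimals[OF po_tensor finite_tensor up[OF open_mono_proj2 this]]
    have "generating (minimals (tensor_le X Y) (proj2 X Y -` W \<inter> tensor_pts X Y))"
      unfolding generating_def using V by blast
    then show ?thesis unfolding tensor_base_iff using eq by metis
  qed
qed

lemma hFor_obj_tensor: "hFor_obj (tensor X Y)"
proof -
  have "tensor_le X Y `` M \<in> tensor_base X Y"
    if U: "U \<in> tensor_base X Y" and M: "M \<subseteq> minimals (tensor_le X Y) U" for U M
  proof -
    obtain T where T: "generating T" "U = tensor_le X Y `` T"
      using U unfolding tensor_base_iff by blast
    then obtain W where "T \<subseteq> minimals (tensor_le X Y) W" unfolding generating_def by blast
    from minimals_upset_of_minimals[OF po_tensor this] have "M \<subseteq> T" using M T(2) by blast
    then show ?thesis using generating_subset[OF T(1)] unfolding tensor_base_iff by blast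
  qed
  moreover have "upset (tensor_pts X Y) (tensor_le X Y) U" if "U \<in> tensor_base X Y" for U
    using that upset_Image[OF po_tensor] unfolding tensor_base_iff by blast
  moreover have "tensor_le X Y `` {u} \<in> tensor_base X Y" if "u \<in> tensor_pts X Y" for u
    using generating_singleton[OF that] unfolding tensor_base_iff by blast
  ultimately have "h_base (tensor_pts X Y) (tensor_le X Y) (tensor_base X Y)"
    unfolding h_base_def by blast
  moreover have "tensor_pts X Y \<in> tensor_base X Y"
  proof -
    have "proj1 X Y -` pts X \<inter> tensor_pts X Y = tensor_pts X Y"
      using open_mono_proj1 unfolding open_mono_def by blast
    moreover have "pts X \<in> base X" using X unfolding hFor_obj_def by blast
    ultimately show ?thesis using vimage_proj_in_base(1)[of "pts X"] by simp
  qed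
  ultimately show ?thesis unfolding hFor_obj_def using forest_tensor by simp
qed

lemma proj_hom:
  "proj1 X Y \<in> hFor_hom (tensor X Y) X" "proj2 X Y \<in> hFor_hom (tensor X Y) Y"
  unfolding hFor_hom_iff
  using open_mono_proj vimage_proj_in_base by (simp_all add: proj1_def proj2_def)

section \<open>Pairing\<close>

context
  fixes Z :: "'z hforest" and f :: "'z \<Rightarrow> 'a" and g :: "'z \<Rightarrow> 'b"
  assumes Z: "hFor_obj Z" and f: "f \<in> hFor_hom Z X" and g: "g \<in> hFor_hom Z Y"
begin

text \<open>
  The only candidate for the mediating map; it is undefined outside \<^term>\<open>pts Z\<close> because morphisms
  are extensional.
\<close>

definition pairing :: "'z \<Rightarrow> ('a \<times> 'b) set" where
  "pairing = (\<lambda>z\<in>pts Z. (\<lambda>w. (f w, g w)) ` under (leq Z) z)"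

lemma po_Z: "partial_order_on (pts Z) (leq Z)"
  using Z unfolding hFor_obj_def finite_forest_def by blast

lemma legs_open: "open_mono (pts Z) (leq Z) (pts X) (leq X) f"
    "open_mono (pts Z) (leq Z) (pts Y) (leq Y) g"
  using f g unfolding hFor_hom_iff by blast+

lemma legs_mono: "(w, z) \<in> leq Z \<Longrightarrow> ((f w, g w), (f z, g z)) \<in> grid_le"
  using legs_open partial_order_onD(1)[OF po_Z] unfolding open_mono_def grid_le_iff by auto

lemma legs_in_grid: "z \<in> pts Z \<Longrightarrow> (f z, g z) \<in> grid"
  using legs_open unfolding open_mono_def by auto

lemma pairing_in_tensor:
  assumes z: "z \<in> pts Z"
  shows "pairing z \<in> tensor_pts X Y" and "tip (pairing z) = (f z, g z)"
proof -
  note D = partial_order_onD[OF po_Z]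
  let ?p = "(\<lambda>w. (f w, g w)) ` under (leq Z) z"
  have p: "pairing z = ?p" using z unfolding pairing_def by simp
  have under: "under (leq Z) z \<subseteq> pts Z" "z \<in> under (leq Z) z"
    using D(1,2) z unfolding under_def by blast+
  have fin: "finite (under (leq Z) z)"
    using Z under(1) finite_subset unfolding hFor_obj_def finite_forest_def by blast
  have ch: "under (leq Z) z \<in> Chains (leq Z)"
    using Z z unfolding hFor_obj_def finite_forest_def by blast
  have "?p \<in> Chains grid_le"
    using ch legs_mono unfolding Chains_def by blast
  moreover have "?p \<inter> minimals grid_le grid \<noteq> {}"
  proof -
    obtain m where m: "m \<in> minimals (leq Z) (under (leq Z) z)"
      using minimal_below[OF po_Z fin under(2)] by blast
    then have mz: "m \<in> under (leq Z) z" and mZ: "m \<in> pts Z" and "(m, z) \<in> leq Z"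
      using under(1) unfolding minimals_def under_def by blast+
    then have min: "w = m" if "(w, m) \<in> leq Z" for w
      using m that D(3)[of w m z] unfolding minimals_def under_def by blast
    have "x = (f m, g m)" if x: "x \<in> grid" "(x, (f m, g m)) \<in> grid_le" for x
    proof -
      have "(fst x, f m) \<in> leq X" "(snd x, g m) \<in> leq Y" "fst x \<in> pts X" "snd x \<in> pts Y"
        using x unfolding grid_le_iff by auto
      then obtain w w' where "(w, m) \<in> leq Z" "f w = fst x" "(w', m) \<in> leq Z" "g w' = snd x"
        using legs_open mZ unfolding open_mono_def by metis
      then show ?thesis using min[of w] min[of w'] by (simp add: prod_eq_iff)
    qed
    \<comment> \<open>An open map sends minimal points to minimal points, so the chain starts at the bottom.\<close>
    then have "(f m, g m) \<in> minimals grid_le grid"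
      using legs_in_grid[OF mZ] unfolding minimals_def by blast
    then show ?thesis using mz by blast
  qed
  moreover have "?p \<subseteq> grid" using legs_in_grid under(1) by blast
  ultimately have US: "pairing z \<in> US grid grid_le"
    unfolding p US_iff[OF po_grid] using fin by blast
  have mem: "(f z, g z) \<in> pairing z" unfolding p using under(2) by blast
  have top: "\<And>x. x \<in> pairing z \<Longrightarrow> (x, (f z, g z)) \<in> grid_le"
    unfolding p using legs_mono by (auto simp: under_def)
  have im1: "fst ` pairing z = under (leq X) (fst (f z, g z))"
    using image_under_open_mono[OF legs_open(1) po_Z po_X z] unfolding p image_image by simp
  have im2: "snd ` pairing z = under (leq Y) (snd (f z, g z))"
    using image_under_open_mono[OF legs_open(2) po_Z po_Y z] unfolding p image_image by simp
  show "pairing z \<in> tensor_pts X Y" "tip (pairing z) = (f z, g z)"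
    using tensorI[OF US mem top im1 im2] by simp_all
qed

text \<open>
  A value \<open>(f v, g v)\<close> with \<open>v \<le> z\<close> not below \<open>w\<close> comes from \<open>v \<ge> w\<close>, hence lies above the tip
  \<open>(f w, g w)\<close> of the smaller chain.  If it is also below some element of that chain, it equals the tip.
\<close>

lemma pairing_segment:
  assumes wz: "(w, z) \<in> leq Z"
  shows "(pairing w, pairing z) \<in> tensor_le X Y"
proof -
  note D = partial_order_onD[OF po_Z]
  have mem: "w \<in> pts Z" "z \<in> pts Z" using wz D(1) by blast+
  have ch: "under (leq Z) z \<in> Chains (leq Z)"
    using Z mem unfolding hFor_obj_def finite_forest_def by blast
  have p: "pairing z = (\<lambda>w. (f w, g w)) ` under (leq Z) z"
      "pairing w = (\<lambda>w. (f w, g w)) ` under (leq Z) w"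
    using mem unfolding pairing_def by simp_all
  have sub: "pairing w \<subseteq> pairing z"
    unfolding p under_def using wz D(3) by blast
  have "y \<in> pairing w" if x: "x \<in> pairing w" and y: "y \<in> pairing z" "(y, x) \<in> grid_le" for x y
  proof -
    obtain v where v: "(v, z) \<in> leq Z" "y = (f v, g v)" using y(1) unfolding p under_def by blast
    show ?thesis
    proof (cases "(v, w) \<in> leq Z")
      case True
      then show ?thesis using v(2) unfolding p under_def by blast
    next
      case False
      then have "(w, v) \<in> leq Z" using ch v(1) wz unfolding Chains_def under_def by blast
      then have "((f w, g w), y) \<in> grid_le" using legs_mono v(2) by simp
      moreover have "(y, (f w, g w)) \<in> grid_le"
        using tensorD(3)[OF pairing_in_tensor(1)[OF mem(1)] x] y(2)
          pairing_in_tensor(2)[OF mem(1)] partial_order_onD(3)[OF po_grid, of y x] by simp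
      ultimately have "y = (f w, g w)" using partial_order_onD(4)[OF po_grid] by blast
      then show ?thesis unfolding p under_def using D(2)[OF mem(1)] by blast
    qed
  qed
  then show ?thesis unfolding tensor_le_iff using sub pairing_in_tensor(1) mem by blast
qed

text \<open>
  A point \<open>q\<close> below \<open>pairing z\<close> has its tip in \<open>pairing z\<close>, so the tip is \<open>(f w, g w)\<close> for some
  \<open>w \<le> z\<close>.  Then \<open>q\<close> and \<open>pairing w\<close> are segments of one chain with the same tip.
\<close>

lemma open_mono_pairing: "open_mono (pts Z) (leq Z) (tensor_pts X Y) (tensor_le X Y) pairing"
proof -
  note D = partial_order_onD[OF po_Z]
  have "\<exists>w\<in>pts Z. (w, z) \<in> leq Z \<and> pairing w = q"
    if z: "z \<in> pts Z" and q: "(q, pairing z) \<in> tensor_le X Y" for z q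
  proof -
    have "tip q \<in> pairing z" using tensor_le_segment(1)[OF q] .
    then obtain w where w: "(w, z) \<in> leq Z" "tip q = (f w, g w)"
      using z unfolding pairing_def under_def by auto
    then have wZ: "w \<in> pts Z" using D(1) by blast
    have "tip q = tip (pairing w)" using w(2) pairing_in_tensor(2)[OF wZ] by simp
    then have "pairing w = q"
      using tensor_le_segment(2)[OF q] tensor_le_segment(2)[OF pairing_segment[OF w(1)]] by simp
    then show ?thesis using w(1) wZ by blast
  qed
  then show ?thesis unfolding open_mono_def using pairing_in_tensor(1) pairing_segment by blast
qed

lemma pairing_hom: "pairing \<in> hFor_hom Z (tensor X Y)"
proof -
  have fb: "\<And>V. V \<in> base X \<Longrightarrow> f -` V \<inter> pts Z \<in> base Z"
    and gb: "\<And>V. V \<in> base Y \<Longrightarrow> g -` V \<inter> pts Z \<in> base Z"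
    using f g unfolding hFor_hom_iff by blast+
  have tip: "proj1 X Y (pairing z) = f z" "proj2 X Y (pairing z) = g z" if "z \<in> pts Z" for z
    using pairing_in_tensor(2)[OF that] by simp_all
  have "pairing -` U \<inter> pts Z \<in> base Z" if U: "U \<in> tensor_base X Y" for U
  proof -
    obtain T where T: "generating T" and U: "U = tensor_le X Y `` T"
      using U unfolding tensor_base_iff by blast
    show ?thesis using T unfolding generating_def
    proof (elim disjE bexE)
      fix V assume V: "V \<in> base X"
        and T: "T \<subseteq> minimals (tensor_le X Y) (proj1 X Y -` V \<inter> tensor_pts X Y)"
      show ?thesis unfolding U
        using vimage_upset_of_minimals[OF Z po_tensor open_mono_pairing tip(1) fb[OF V] T] .
    next
      fix V assume V: "V \<in> base Y"
        and T: "T \<subseteq> minimals (tensor_le X Y) (proj2 X Y -` V \<inter> tensor_pts X Y)"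
      show ?thesis unfolding U
        using vimage_upset_of_minimals[OF Z po_tensor open_mono_pairing tip(2) gb[OF V] T] .
    qed
  qed
  moreover have "pairing \<in> extensional (pts Z)" unfolding pairing_def by simp
  ultimately show ?thesis unfolding hFor_hom_iff using open_mono_pairing by simp
qed

lemma compose_proj_pairing:
  "compose (pts Z) (proj1 X Y) pairing = f" "compose (pts Z) (proj2 X Y) pairing = g"
proof -
  have ext: "f \<in> extensional (pts Z)" "g \<in> extensional (pts Z)"
    using f g unfolding hFor_hom_iff by blast+
  show "compose (pts Z) (proj1 X Y) pairing = f"
    using pairing_in_tensor(2) by (intro extensionalityI[OF compose_extensional ext(1)])
      (simp add: compose_eq)
  show "compose (pts Z) (proj2 X Y) pairing = g"
    using pairing_in_tensor(2) by (intro extensionalityI[OF compose_extensional ext(2)])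
      (simp add: compose_eq)
qed

text \<open>
  The elements of \<open>h z\<close> are the tips of the points below \<open>h z\<close>.  As \<open>h\<close> is open and monotone, these
  points are the \<open>h w\<close> with \<open>w \<le> z\<close>, and the projections dictate their tips.
\<close>

lemma pairing_unique:
  assumes h: "h \<in> hFor_hom Z (tensor X Y)"
    and h1: "compose (pts Z) (proj1 X Y) h = f" and h2: "compose (pts Z) (proj2 X Y) h = g"
  shows "h = pairing"
proof (rule extensionalityI)
  have ho: "open_mono (pts Z) (leq Z) (tensor_pts X Y) (tensor_le X Y) h"
    and ext: "h \<in> extensional (pts Z)"
    using h unfolding hFor_hom_iff by simp_all
  show "h \<in> extensional (pts Z)" by fact
  show "pairing \<in> extensional (pts Z)" unfolding pairing_def by simp
  note D = partial_order_onD[OF po_Z]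
  have tip: "tip (h w) = (f w, g w)" if "w \<in> pts Z" for w
    using that by (simp add: h1[symmetric] h2[symmetric] compose_eq)
  fix z assume z: "z \<in> pts Z"
  then have hz: "h z \<in> tensor_pts X Y" using ho unfolding open_mono_def by blast
  have "x \<in> h z \<longleftrightarrow> x \<in> pairing z" for x
  proof
    assume x: "x \<in> h z"
    let ?q = "{y \<in> h z. (y, x) \<in> grid_le}"
    have q: "(?q, h z) \<in> tensor_le X Y" "tip ?q = x" using initial_segment[OF hz x] .
    then obtain w where w: "w \<in> pts Z" "(w, z) \<in> leq Z" "h w = ?q"
      using ho z tensor_le_iff[of ?q "h z"] unfolding open_mono_def by blast
    have "x = (f w, g w)" using tip[OF w(1)] q(2) unfolding w(3) by simp
    then show "x \<in> pairing z" using w(2) z unfolding pairing_def under_def by auto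
  next
    assume "x \<in> pairing z"
    then obtain w where w: "(w, z) \<in> leq Z" "x = (f w, g w)"
      using z unfolding pairing_def under_def by auto
    then have wZ: "w \<in> pts Z" using D(1) by blast
    then have "(h w, h z) \<in> tensor_le X Y" using ho z w(1) unfolding open_mono_def by blast
    from tensor_le_segment(1)[OF this] show "x \<in> h z" using tip[OF wZ] w(2) by simp
  qed
  then show "h z = pairing z" by blast
qed

end

end

theorem theorem5:
  fixes X :: "'a hforest" and Y :: "'b hforest"
  assumes "hFor_obj X" and "hFor_obj Y"
  shows "hFor_product TYPE('z) X Y (tensor X Y) (proj1 X Y) (proj2 X Y)"
proof -
  have "\<exists>!h. h \<in> hFor_hom Z (tensor X Y) \<and>
      compose (pts Z) (proj1 X Y) h = f \<and> compose (pts Z) (proj2 X Y) h = g"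
    if Z: "hFor_obj Z" and f: "f \<in> hFor_hom Z X" and g: "g \<in> hFor_hom Z Y"
    for Z :: "'z hforest" and f g
    by (rule ex1I[of _ "pairing Z f g"])
      (use pairing_hom[OF assms Z f g] compose_proj_pairing[OF assms Z f g]
        pairing_unique[OF assms Z f g] in blast)+
  then show ?thesis
    unfolding hFor_product_def using hFor_obj_tensor[OF assms] proj_hom[OF assms] by blast
qed

end
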